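(* Let $G$ be a Lie group acting transitively on a manifold $M$, let a stage tree be given, and consider motions, the skeleton $\Sigma$ they define, and an isotropy map $\varpi$. Then: (i) if the motions have the form $\Psi_{i,j} = \Psi\circ\theta_{i,j}$ for a motion map $\Psi$ and transition functions $\theta_{i,j}$, and if $\Psi$ and all the $\theta_{i,j}$ are equivariant, then so are the motions $\Psi_{i,j}$; (ii) if all the motions $\Psi_{i,j}$ are equivariant, then so is the skeleton $\Sigma$; (iii) if the skeleton $\Sigma$ and the isotropy map $\varpi$ are equivariant, then so is the method $\Phi = \Sigma\circ\varpi$.
   Context: Setting: $G$ is a Lie group (treated as a matrix group) with Lie algebra $\mathfrak g$, acting smoothly and transitively on a smooth manifold $M$; the action is written $g\cdot x$. For $\xi\in\mathfrak g$, $\xi\cdot x\in T_xM$ is the infinitesimal action. $G$ acts on $\mathfrak g$ by $g\cdot\xi = g\xi g^{-1}$, on $\mathfrak g^n$ componentwise, on vector fields by $(g\cdot f)(x) = Tg\, f(g^{-1}\cdot x)$ (where $Tg$ is the tangent map of $x\mapsto g\cdot x$), and on $\nu\in C^\infty(M,\mathfrak g)$ by $(g\cdot\nu)(x) = g\cdot\nu(g^{-1}\cdot x)$. Isotropy map: a linear map $\varpi$ from the space $\mathfrak X(M)$ of vector fields to $C^\infty(M,\mathfrak g)$, written $f\mapsto\langle\varpi,f\rangle$, such that $\langle\varpi,f\rangle(x)\cdot x = f(x)$ for all $x\in M$ and $f\in\mathfrak X(M)$. It is equivariant if $\langle\varpi,g\cdot f\rangle = g\cdot\langle\varpi,f\rangle$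 for all $g\in G$ and $f$. Skeleton: a stage tree is a finite tree (connected undirected graph without cycles) with $n$ vertices, two of which are singled out: the initial vertex $\circ$ and the final vertex $\bullet$. Motions are maps $\Psi_{i,j}\colon\mathfrak g^n\to G$, one for each ordered pair of adjacent vertices $i,j$, with $\Psi_{i,j}(F) = \Psi_{j,i}(F)^{-1}$. Given $\nu\in C^\infty(M,\mathfrak g)$ and $x_0\in M$, the point $x_1=\Sigma(\nu)(x_0)$ is defined by the system, with unknowns $X_i\in M$ and $F_i\in\mathfrak g$ indexed by the vertices: $X_\circ = x_0$; $X_i = \Psi_{i,j}(F)\cdot X_j$ for every edge $i,j$; $F_i=\nu(X_i)$ for every vertex $i$; $x_1=X_\bullet$. Standing assumption: $\nu$ is always scaled so that this system has exactly one solution and $\Sigma(\nu)$ is a diffeomorphism of $M$. The map $\nu\mapsto\Sigma(\nu)$ is called the skeleton. A motion map is a map $\Psi\colon\mathfrak g\to G$ with $\Psi(-\xi)=\Psi(\xi)^{-1}$. Transition functions are maps $\theta_{i,j}\colon\mathfrak g^n\to\mathfrak g$, for adjacent $i,j$, with $\theta_{i,j}(F) = -\theta_{j,i}(F)$. Equivariance, for all $g\in G$: of $\Psi$ means $\Psi(g\cdot\xi) = g\,\Psi(\xi)\,g^{-1}$; of $\theta_{i,j}$ means $\theta_{i,j}(g\cdot F) = g\cdot\theta_{i,j}(F)$; of $\Psi_{i,j}$ means $\Psi_{i,j}(g\cdot F) = g\,\Psi_{i,j}(F)\,g^{-1}$; of $\Sigma$ means $\Sigma(g\cdot\nu)(g\cdot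 x) = g\cdot\Sigma(\nu)(x)$; of a method $\Phi$ (a map from vector fields to diffeomorphisms) means $\Phi(g\cdot f)(g\cdot x) = g\cdot\Phi(f)(x)$. The method $\Phi=\Sigma\circ\varpi$ is $\Phi(f) = \Sigma(\langle\varpi,f\rangle)$. *)

theory Defs
  imports "HOL-Analysis.Analysis" "HOL-Algebra.Group_Action"
begin

section \<open>Smooth manifolds\<close>

text \<open>On an open set \<open>S\<close> of a finite-dimensional space, \<open>f\<close> is \<open>C\<^sup>k\<close>: all iterated directional
  derivatives up to order \<open>k\<close> exist and are continuous.\<close>

primrec C_on :: "nat \<Rightarrow> 'a::real_normed_vector set \<Rightarrow> ('a \<Rightarrow> 'b::real_normed_vector) \<Rightarrow> bool"
  where
    "C_on 0 S f \<longleftrightarrow> continuous_on S f"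
  | "C_on (Suc k) S f \<longleftrightarrow>
       (\<forall>x\<in>S. f differentiable (at x)) \<and>
       (\<forall>v. C_on k S (\<lambda>x. frechet_derivative f (at x) v))"

definition smooth_on :: "'a::real_normed_vector set \<Rightarrow> ('a \<Rightarrow> 'b::real_normed_vector) \<Rightarrow> bool"
  where "smooth_on S f \<longleftrightarrow> (\<forall>k. C_on k S f)"

text \<open>A space with this property is a copy of \<open>\<real>\<^sup>n\<close>. Unlike the class \<open>euclidean_space\<close>,
  it includes the case \<open>n = 0\<close>, hence discrete groups and one-point manifolds.\<close>

definition has_finite_orthonormal_basis :: "'e::real_inner itself \<Rightarrow> bool"
  where "has_finite_orthonormal_basis _ \<longleftrightarrow>
    (\<exists>B::'e set. finite B \<and> (\<forall>u\<in>B. \<forall>v\<in>B. inner u v = (if u = v then 1 else 0)) \<and> span B = UNIV)"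

text \<open>A chart \<open>(U, \<phi>)\<close> has domain \<open>U\<close> and takes its values in the model space \<open>'e\<close>;
  \<open>\<phi>\<close> is irrelevant outside \<open>U\<close>. The atlas need not be maximal.\<close>

record ('m, 'e) manifold =
  topo :: "'m topology"
  charts :: "('m set \<times> ('m \<Rightarrow> 'e)) set"

abbreviation points :: "('m, 'e, 'z) manifold_scheme \<Rightarrow> 'm set"
  where "points M \<equiv> topspace (topo M)"

definition smooth_manifold :: "('m, 'e::real_inner) manifold \<Rightarrow> bool"
  where "smooth_manifold M \<longleftrightarrow>
    has_finite_orthonormal_basis TYPE('e) \<and>
    Hausdorff_space (topo M) \<and> second_countable (topo M) \<and>
    (\<Union>(U, \<phi>)\<in>charts M. U) = points M \<and>
    (\<forall>(U, \<phi>)\<in>charts M. openin (topo M) U \<and> open (\<phi> ` U) \<and>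
       homeomorphic_map (subtopology (topo M) U) (top_of_set (\<phi> ` U)) \<phi>) \<and>
    (\<forall>(U, \<phi>)\<in>charts M. \<forall>(W, \<psi>)\<in>charts M.
       smooth_on (\<phi> ` (U \<inter> W)) (\<lambda>y. \<psi> (inv_into U \<phi> y)))"

definition smooth_map ::
    "('m, 'e::real_inner) manifold \<Rightarrow> ('n, 'f::real_inner) manifold \<Rightarrow> ('m \<Rightarrow> 'n) \<Rightarrow> bool"
  where "smooth_map M N h \<longleftrightarrow>
    continuous_map (topo M) (topo N) h \<and>
    (\<forall>(U, \<phi>)\<in>charts M. \<forall>(W, \<psi>)\<in>charts N.
       smooth_on (\<phi> ` (U \<inter> h -` W)) (\<lambda>y. \<psi> (h (inv_into U \<phi> y))))"

definition diffeomorphism :: "('m, 'e::real_inner) manifold \<Rightarrow> ('m \<Rightarrow> 'm) \<Rightarrow> bool"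
  where "diffeomorphism M h \<longleftrightarrow>
    bij_betw h (points M) (points M) \<and>
    smooth_map M M h \<and> smooth_map M M (inv_into (points M) h)"

definition prod_manifold ::
    "('m, 'e) manifold \<Rightarrow> ('n, 'f) manifold \<Rightarrow> ('m \<times> 'n, 'e \<times> 'f) manifold"
  where "prod_manifold M N =
    \<lparr>topo = prod_topology (topo M) (topo N),
     charts = {(U \<times> W, map_prod \<phi> \<psi>) | U \<phi> W \<psi>. (U, \<phi>) \<in> charts M \<and> (W, \<psi>) \<in> charts N}\<rparr>"

definition real_line :: "(real, real) manifold"
  where "real_line = \<lparr>topo = euclidean, charts = {(UNIV, id)}\<rparr>"

section \<open>Tangent vectors and vector fields\<close>

text \<open>The algebra of smooth real functions on \<open>M\<close>. Functions on \<open>M\<close> are represented by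
  functions on the ambient type which vanish outside \<open>M\<close>, so that equality is equality on \<open>M\<close>.\<close>

definition smooth_functions :: "('m, 'e::real_inner) manifold \<Rightarrow> ('m \<Rightarrow> real) set"
  where "smooth_functions M =
    {p. smooth_map M real_line p \<and> (\<forall>x. x \<notin> points M \<longrightarrow> p x = 0)}"

text \<open>Tangent vectors at \<open>x\<close> are the derivations at \<open>x\<close> of the algebra of smooth functions,
  again made extensional by the value 0 outside their domain. Sums and multiples of tangent
  vectors are pointwise.\<close>

type_synonym 'm tangent = "('m \<Rightarrow> real) \<Rightarrow> real"

definition tangent_space :: "('m, 'e::real_inner) manifold \<Rightarrow> 'm \<Rightarrow> 'm tangent set"
  where "tangent_space M x =
    {v. (\<forall>p. p \<notin> smooth_functions M \<longrightarrow> v p = 0) \<and>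
        (\<forall>p\<in>smooth_functions M. \<forall>q\<in>smooth_functions M.
          (\<forall>a b. v (\<lambda>y. a * p y + b * q y) = a * v p + b * v q) \<and>
          v (\<lambda>y. p y * q y) = p x * v q + q x * v p)}"

text \<open>The tangent map \<open>v \<mapsto> (p \<mapsto> v (p \<circ> h))\<close> of \<open>h : M \<rightarrow> N\<close>.\<close>

definition tangent_map ::
    "('m, 'e::real_inner) manifold \<Rightarrow> ('n, 'f::real_inner) manifold \<Rightarrow> ('m \<Rightarrow> 'n) \<Rightarrow>
     'm tangent \<Rightarrow> 'n tangent"
  where "tangent_map M N h v =
    (\<lambda>p. if p \<in> smooth_functions N then v (\<lambda>y. if y \<in> points M then p (h y) else 0) else 0)"

definition vector_fields :: "('m, 'e::real_inner) manifold \<Rightarrow> ('m \<Rightarrow> 'm tangent) set"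
  where "vector_fields M =
    {f. (\<forall>x\<in>points M. f x \<in> tangent_space M x) \<and>
        (\<forall>x. x \<notin> points M \<longrightarrow> f x = (\<lambda>_. 0)) \<and>
        (\<forall>p\<in>smooth_functions M. smooth_map M real_line (\<lambda>x. f x p))}"

section \<open>Lie groups and smooth actions\<close>

record ('g, 'e) lie_group_data = "'g monoid" +
  manifold_of :: "('g, 'e) manifold"

definition lie_group :: "('g, 'e::real_inner) lie_group_data \<Rightarrow> bool"
  where "lie_group G \<longleftrightarrow>
    group G \<and> smooth_manifold (manifold_of G) \<and> points (manifold_of G) = carrier G \<and>
    smooth_map (prod_manifold (manifold_of G) (manifold_of G)) (manifold_of G)
      (\<lambda>(g, h). g \<otimes>\<^bsub>G\<^esub> h) \<and>
    smooth_map (manifold_of G) (manifold_of G) (\<lambda>g. inv\<^bsub>G\<^esub> g)"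

definition lie_algebra :: "('g, 'e::real_inner) lie_group_data \<Rightarrow> 'g tangent set"
  where "lie_algebra G = tangent_space (manifold_of G) \<one>\<^bsub>G\<^esub>"

text \<open>The adjoint action, i.e. the tangent map at 1 of \<open>h \<mapsto> g h g\<^sup>-\<^sup>1\<close>. On a matrix group this is
  \<open>\<xi> \<mapsto> g \<xi> g\<^sup>-\<^sup>1\<close>.\<close>

definition Ad :: "('g, 'e::real_inner) lie_group_data \<Rightarrow> 'g \<Rightarrow> 'g tangent \<Rightarrow> 'g tangent"
  where "Ad G g = tangent_map (manifold_of G) (manifold_of G) (\<lambda>h. g \<otimes>\<^bsub>G\<^esub> h \<otimes>\<^bsub>G\<^esub> inv\<^bsub>G\<^esub> g)"

definition smooth_transitive_action ::
    "('g, 'a::real_inner) lie_group_data \<Rightarrow> ('m, 'b::real_inner) manifold \<Rightarrow> ('g \<Rightarrow> 'm \<Rightarrow> 'm) \<Rightarrow> bool"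
  where "smooth_transitive_action G M act \<longleftrightarrow>
    transitive_action G (points M) act \<and>
    smooth_map (prod_manifold (manifold_of G) M) M (\<lambda>(g, x). act g x)"

text \<open>The infinitesimal action \<open>\<xi> \<cdot> x\<close>: tangent map at 1 of \<open>h \<mapsto> h \<cdot> x\<close>.\<close>

definition inf_act ::
    "('g, 'a::real_inner) lie_group_data \<Rightarrow> ('m, 'b::real_inner) manifold \<Rightarrow> ('g \<Rightarrow> 'm \<Rightarrow> 'm) \<Rightarrow>
     'g tangent \<Rightarrow> 'm \<Rightarrow> 'm tangent"
  where "inf_act G M act \<xi> x = tangent_map (manifold_of G) M (\<lambda>h. act h x) \<xi>"

definition act_field ::
    "('g, 'a::real_inner) lie_group_data \<Rightarrow> ('m, 'b::real_inner) manifold \<Rightarrow> ('g \<Rightarrow> 'm \<Rightarrow> 'm) \<Rightarrow>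
     'g \<Rightarrow> ('m \<Rightarrow> 'm tangent) \<Rightarrow> 'm \<Rightarrow> 'm tangent"
  where "act_field G M act g f =
    (\<lambda>x. if x \<in> points M then tangent_map M M (act g) (f (act (inv\<^bsub>G\<^esub> g) x)) else (\<lambda>_. 0))"

text \<open>The space \<open>C\<^sup>\<infinity>(M, \<gg>)\<close>. The Lie algebra is a finite-dimensional vector space, so \<open>\<nu>\<close> is
  smooth iff \<open>l \<circ> \<nu>\<close> is smooth for every linear functional \<open>l\<close> on it.\<close>

definition smooth_lie_maps ::
    "('g, 'a::real_inner) lie_group_data \<Rightarrow> ('m, 'b::real_inner) manifold \<Rightarrow> ('m \<Rightarrow> 'g tangent) set"
  where "smooth_lie_maps G M =
    {\<nu>. (\<forall>x\<in>points M. \<nu> x \<in> lie_algebra G) \<and>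
        (\<forall>x. x \<notin> points M \<longrightarrow> \<nu> x = (\<lambda>_. 0)) \<and>
        (\<forall>l::'g tangent \<Rightarrow> real.
          (\<forall>\<xi>\<in>lie_algebra G. \<forall>\<eta>\<in>lie_algebra G. \<forall>a b.
             l (\<lambda>p. a * \<xi> p + b * \<eta> p) = a * l \<xi> + b * l \<eta>) \<longrightarrow>
          smooth_map M real_line (\<lambda>x. l (\<nu> x)))}"

definition act_lie_map ::
    "('g, 'a::real_inner) lie_group_data \<Rightarrow> ('m, 'b::real_inner) manifold \<Rightarrow> ('g \<Rightarrow> 'm \<Rightarrow> 'm) \<Rightarrow>
     'g \<Rightarrow> ('m \<Rightarrow> 'g tangent) \<Rightarrow> 'm \<Rightarrow> 'g tangent"
  where "act_lie_map G M act g \<nu> =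
    (\<lambda>x. if x \<in> points M then Ad G g (\<nu> (act (inv\<^bsub>G\<^esub> g) x)) else (\<lambda>_. 0))"

section \<open>Isotropy maps\<close>

definition isotropy_map ::
    "('g, 'a::real_inner) lie_group_data \<Rightarrow> ('m, 'b::real_inner) manifold \<Rightarrow> ('g \<Rightarrow> 'm \<Rightarrow> 'm) \<Rightarrow>
     (('m \<Rightarrow> 'm tangent) \<Rightarrow> 'm \<Rightarrow> 'g tangent) \<Rightarrow> bool"
  where "isotropy_map G M act \<omega> \<longleftrightarrow>
    (\<forall>f\<in>vector_fields M. \<omega> f \<in> smooth_lie_maps G M) \<and>
    (\<forall>f\<in>vector_fields M. \<forall>h\<in>vector_fields M. \<forall>a b.
       \<omega> (\<lambda>x p. a * f x p + b * h x p) = (\<lambda>x p. a * \<omega> f x p + b * \<omega> h x p)) \<and>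
    (\<forall>f\<in>vector_fields M. \<forall>x\<in>points M. inf_act G M act (\<omega> f x) x = f x)"

definition equivariant_isotropy ::
    "('g, 'a::real_inner) lie_group_data \<Rightarrow> ('m, 'b::real_inner) manifold \<Rightarrow> ('g \<Rightarrow> 'm \<Rightarrow> 'm) \<Rightarrow>
     (('m \<Rightarrow> 'm tangent) \<Rightarrow> 'm \<Rightarrow> 'g tangent) \<Rightarrow> bool"
  where "equivariant_isotropy G M act \<omega> \<longleftrightarrow>
    (\<forall>g\<in>carrier G. \<forall>f\<in>vector_fields M.
       \<omega> (act_field G M act g f) = act_lie_map G M act g (\<omega> f))"

section \<open>Stage trees and motions\<close>

record 'v stage_tree_data =
  stages :: "'v set"
  edges :: "('v \<times> 'v) set"
  initial :: 'v
  final :: 'v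

text \<open>A simple undirected graph is a symmetric irreflexive relation. The list in the last clause
  is a cycle.\<close>

definition stage_tree :: "'v stage_tree_data \<Rightarrow> bool"
  where "stage_tree T \<longleftrightarrow>
    finite (stages T) \<and> edges T \<subseteq> stages T \<times> stages T \<and> sym (edges T) \<and> irrefl (edges T) \<and>
    initial T \<in> stages T \<and> final T \<in> stages T \<and> initial T \<noteq> final T \<and>
    (\<forall>i\<in>stages T. \<forall>j\<in>stages T. (i, j) \<in> (edges T)\<^sup>*) \<and>
    \<not> (\<exists>c. 3 \<le> length c \<and> distinct c \<and>
           (\<forall>k<length c. (c ! k, c ! (Suc k mod length c)) \<in> edges T))"

text \<open>\<open>\<gg>\<^sup>n\<close>, with components indexed by the vertices.\<close>

definition stage_values ::
    "('g, 'a::real_inner) lie_group_data \<Rightarrow> 'v stage_tree_data \<Rightarrow> ('v \<Rightarrow> 'g tangent) set"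
  where "stage_values G T = stages T \<rightarrow>\<^sub>E lie_algebra G"

definition Ad_stages ::
    "('g, 'a::real_inner) lie_group_data \<Rightarrow> 'v stage_tree_data \<Rightarrow> 'g \<Rightarrow>
     ('v \<Rightarrow> 'g tangent) \<Rightarrow> 'v \<Rightarrow> 'g tangent"
  where "Ad_stages G T g F = (\<lambda>i\<in>stages T. Ad G g (F i))"

definition motions ::
    "('g, 'a::real_inner) lie_group_data \<Rightarrow> 'v stage_tree_data \<Rightarrow>
     ('v \<Rightarrow> 'v \<Rightarrow> ('v \<Rightarrow> 'g tangent) \<Rightarrow> 'g) \<Rightarrow> bool"
  where "motions G T \<Psi> \<longleftrightarrow>
    (\<forall>(i, j)\<in>edges T. \<forall>F\<in>stage_values G T.
       \<Psi> i j F \<in> carrier G \<and> \<Psi> i j F = inv\<^bsub>G\<^esub> (\<Psi> j i F))"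

definition equivariant_motions ::
    "('g, 'a::real_inner) lie_group_data \<Rightarrow> 'v stage_tree_data \<Rightarrow>
     ('v \<Rightarrow> 'v \<Rightarrow> ('v \<Rightarrow> 'g tangent) \<Rightarrow> 'g) \<Rightarrow> bool"
  where "equivariant_motions G T \<Psi> \<longleftrightarrow>
    (\<forall>(i, j)\<in>edges T. \<forall>g\<in>carrier G. \<forall>F\<in>stage_values G T.
       \<Psi> i j (Ad_stages G T g F) = g \<otimes>\<^bsub>G\<^esub> \<Psi> i j F \<otimes>\<^bsub>G\<^esub> inv\<^bsub>G\<^esub> g)"

definition motion_map ::
    "('g, 'a::real_inner) lie_group_data \<Rightarrow> ('g tangent \<Rightarrow> 'g) \<Rightarrow> bool"
  where "motion_map G \<psi> \<longleftrightarrow>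
    (\<forall>\<xi>\<in>lie_algebra G. \<psi> \<xi> \<in> carrier G \<and> \<psi> (- \<xi>) = inv\<^bsub>G\<^esub> (\<psi> \<xi>))"

definition equivariant_motion_map ::
    "('g, 'a::real_inner) lie_group_data \<Rightarrow> ('g tangent \<Rightarrow> 'g) \<Rightarrow> bool"
  where "equivariant_motion_map G \<psi> \<longleftrightarrow>
    (\<forall>g\<in>carrier G. \<forall>\<xi>\<in>lie_algebra G. \<psi> (Ad G g \<xi>) = g \<otimes>\<^bsub>G\<^esub> \<psi> \<xi> \<otimes>\<^bsub>G\<^esub> inv\<^bsub>G\<^esub> g)"

definition transition_functions ::
    "('g, 'a::real_inner) lie_group_data \<Rightarrow> 'v stage_tree_data \<Rightarrow>
     ('v \<Rightarrow> 'v \<Rightarrow> ('v \<Rightarrow> 'g tangent) \<Rightarrow> 'g tangent) \<Rightarrow> bool"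
  where "transition_functions G T \<theta> \<longleftrightarrow>
    (\<forall>(i, j)\<in>edges T. \<forall>F\<in>stage_values G T.
       \<theta> i j F \<in> lie_algebra G \<and> \<theta> i j F = - \<theta> j i F)"

definition equivariant_transition_functions ::
    "('g, 'a::real_inner) lie_group_data \<Rightarrow> 'v stage_tree_data \<Rightarrow>
     ('v \<Rightarrow> 'v \<Rightarrow> ('v \<Rightarrow> 'g tangent) \<Rightarrow> 'g tangent) \<Rightarrow> bool"
  where "equivariant_transition_functions G T \<theta> \<longleftrightarrow>
    (\<forall>(i, j)\<in>edges T. \<forall>g\<in>carrier G. \<forall>F\<in>stage_values G T.
       \<theta> i j (Ad_stages G T g F) = Ad G g (\<theta> i j F))"

section \<open>The skeleton\<close>

definition skeleton_solution ::
    "('g, 'a::real_inner) lie_group_data \<Rightarrow> ('m, 'b::real_inner) manifold \<Rightarrow> ('g \<Rightarrow> 'm \<Rightarrow> 'm) \<Rightarrow>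
     'v stage_tree_data \<Rightarrow> ('v \<Rightarrow> 'v \<Rightarrow> ('v \<Rightarrow> 'g tangent) \<Rightarrow> 'g) \<Rightarrow>
     ('m \<Rightarrow> 'g tangent) \<Rightarrow> 'm \<Rightarrow> ('v \<Rightarrow> 'm) \<times> ('v \<Rightarrow> 'g tangent) \<Rightarrow> bool"
  where "skeleton_solution G M act T \<Psi> \<nu> x0 = (\<lambda>(X, F).
    X \<in> stages T \<rightarrow>\<^sub>E points M \<and> F \<in> stage_values G T \<and>
    X (initial T) = x0 \<and>
    (\<forall>(i, j)\<in>edges T. X i = act (\<Psi> i j F) (X j)) \<and>
    (\<forall>i\<in>stages T. F i = \<nu> (X i)))"

text \<open>Meaningful for \<open>\<nu> \<in> scaled\<close>, \<open>x0 \<in> points M\<close>, see below.\<close>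

definition skeleton ::
    "('g, 'a::real_inner) lie_group_data \<Rightarrow> ('m, 'b::real_inner) manifold \<Rightarrow> ('g \<Rightarrow> 'm \<Rightarrow> 'm) \<Rightarrow>
     'v stage_tree_data \<Rightarrow> ('v \<Rightarrow> 'v \<Rightarrow> ('v \<Rightarrow> 'g tangent) \<Rightarrow> 'g) \<Rightarrow>
     ('m \<Rightarrow> 'g tangent) \<Rightarrow> 'm \<Rightarrow> 'm"
  where "skeleton G M act T \<Psi> \<nu> x0 =
    fst (THE XF. skeleton_solution G M act T \<Psi> \<nu> x0 XF) (final T)"

text \<open>The \<open>\<nu>\<close> which are scaled so that the system has exactly one solution for every initial
  point and the resulting map is a diffeomorphism; the domain of the skeleton.\<close>

definition scaled ::
    "('g, 'a::real_inner) lie_group_data \<Rightarrow> ('m, 'b::real_inner) manifold \<Rightarrow> ('g \<Rightarrow> 'm \<Rightarrow> 'm) \<Rightarrow>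
     'v stage_tree_data \<Rightarrow> ('v \<Rightarrow> 'v \<Rightarrow> ('v \<Rightarrow> 'g tangent) \<Rightarrow> 'g) \<Rightarrow>
     ('m \<Rightarrow> 'g tangent) set"
  where "scaled G M act T \<Psi> =
    {\<nu> \<in> smooth_lie_maps G M.
      (\<forall>x0\<in>points M. \<exists>!XF. skeleton_solution G M act T \<Psi> \<nu> x0 XF) \<and>
      diffeomorphism M (skeleton G M act T \<Psi> \<nu>)}"

text \<open>Skeletons and methods are partial maps into the diffeomorphisms of \<open>M\<close>. Equivariance of
  \<open>\<Sigma>\<close> with domain \<open>D\<close> includes that \<open>D\<close> is invariant, so that the left-hand side of the
  equation is the value of \<open>\<Sigma>\<close> at a point of its domain.\<close>

definition equivariant_on ::
    "('g, 'a::real_inner) lie_group_data \<Rightarrow> ('m, 'b::real_inner) manifold \<Rightarrow> ('g \<Rightarrow> 'm \<Rightarrow> 'm) \<Rightarrow>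
     ('g \<Rightarrow> 'n \<Rightarrow> 'n) \<Rightarrow> 'n set \<Rightarrow> ('n \<Rightarrow> 'm \<Rightarrow> 'm) \<Rightarrow> bool"
  where "equivariant_on G M act actD D \<Sigma> \<longleftrightarrow>
    (\<forall>g\<in>carrier G. \<forall>\<nu>\<in>D. actD g \<nu> \<in> D \<and>
       (\<forall>x\<in>points M. \<Sigma> (actD g \<nu>) (act g x) = act g (\<Sigma> \<nu> x)))"

definition equivariant_skeleton ::
    "('g, 'a::real_inner) lie_group_data \<Rightarrow> ('m, 'b::real_inner) manifold \<Rightarrow> ('g \<Rightarrow> 'm \<Rightarrow> 'm) \<Rightarrow>
     'v stage_tree_data \<Rightarrow> ('v \<Rightarrow> 'v \<Rightarrow> ('v \<Rightarrow> 'g tangent) \<Rightarrow> 'g) \<Rightarrow> bool"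
  where "equivariant_skeleton G M act T \<Psi> \<longleftrightarrow>
    equivariant_on G M act (act_lie_map G M act) (scaled G M act T \<Psi>) (skeleton G M act T \<Psi>)"

definition equivariant_method ::
    "('g, 'a::real_inner) lie_group_data \<Rightarrow> ('m, 'b::real_inner) manifold \<Rightarrow> ('g \<Rightarrow> 'm \<Rightarrow> 'm) \<Rightarrow>
     'v stage_tree_data \<Rightarrow> ('v \<Rightarrow> 'v \<Rightarrow> ('v \<Rightarrow> 'g tangent) \<Rightarrow> 'g) \<Rightarrow>
     (('m \<Rightarrow> 'm tangent) \<Rightarrow> 'm \<Rightarrow> 'g tangent) \<Rightarrow> bool"
  where "equivariant_method G M act T \<Psi> \<omega> \<longleftrightarrow>
    equivariant_on G M act (act_field G M act)
      {f \<in> vector_fields M. \<omega> f \<in> scaled G M act T \<Psi>}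
      (skeleton G M act T \<Psi> \<circ> \<omega>)"

end

theory Submission
  imports Defs
begin

text \<open>
  If \<open>(X, F)\<close> solves the skeleton system for \<open>\<nu>\<close> and \<open>x\<^sub>0\<close>, then the translate \<open>(g \<cdot> X, g \<cdot> F)\<close> solves it for
  \<open>g \<cdot> \<nu>\<close> and \<open>g \<cdot> x\<^sub>0\<close>, since \<open>\<Psi>\<^sub>i\<^sub>j(g \<cdot> F) \<cdot> (g \<cdot> X\<^sub>j) = g \<Psi>\<^sub>i\<^sub>j(F) g\<^sup>-\<^sup>1 g \<cdot> X\<^sub>j = g \<cdot> X\<^sub>i\<close>. Translation by \<open>g\<^sup>-\<^sup>1\<close>
  is inverse to this, so existence and uniqueness carry over and \<open>\<Sigma>(g \<cdot> \<nu>) = g \<circ> \<Sigma>(\<nu>) \<circ> g\<^sup>-\<^sup>1\<close>, again a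
  diffeomorphism. The analytic part is that \<open>g \<cdot> \<nu>\<close> and \<open>g \<cdot> f\<close> are smooth, which comes down to
  smooth maps being closed under composition.
\<close>

section \<open>Functions of class \<open>C\<^sup>k\<close>\<close>

text \<open>A Frechet derivative at a point of an open set depends only on the values in that set,
  so agreement on \<open>S\<close> passes to all iterated derivatives.\<close>

lemma C_on_cong:
  assumes "open S" "\<And>x. x \<in> S \<Longrightarrow> f x = g x" "C_on k S f"
  shows "C_on k S g"
  using assms(2,3)
proof (induction k arbitrary: f g)
  case 0
  then show ?case
    by (auto cong: continuous_on_cong)
next
  case (Suc k)
  have der: "frechet_derivative f (at x) = frechet_derivative g (at x)" "g differentiable (at x)"
    if "x \<in> S" for x
  proof -
    have d: "f differentiable (at x)"
      using Suc.prems that by simp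
    show "frechet_derivative f (at x) = frechet_derivative g (at x)"
      using frechet_derivative_transform_within_open[OF d \<open>open S\<close> that] Suc.prems by blast
    show "g differentiable (at x)"
      using d has_derivative_transform_within_open[OF _ \<open>open S\<close> that] Suc.prems(1)
      unfolding differentiable_def by blast
  qed
  have "C_on k S (\<lambda>x. frechet_derivative g (at x) v)" for v
    by (rule Suc.IH[of "\<lambda>x. frechet_derivative f (at x) v"]) (use der Suc.prems in auto)
  with der show ?case
    by simp
qed

text \<open>Derivatives are unique, so any explicit formula \<open>D\<close> may stand in for
  \<open>frechet_derivative\<close>; the closure rules below take \<open>D\<close> from the usual
  differentiation rules.\<close>

lemma C_on_SucI:
  assumes "open S" "\<And>x. x \<in> S \<Longrightarrow> (f has_derivative D x) (at x)"
    and "\<And>v. C_on k S (\<lambda>x. D x v)"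
  shows "C_on (Suc k) S f"
proof -
  have "C_on k S (\<lambda>x. frechet_derivative f (at x) v)" for v
    by (rule C_on_cong[OF assms(1) _ assms(3)[of v]]) (metis assms(2) frechet_derivative_at)
  then show ?thesis
    using assms(2) by (auto simp: differentiable_def)
qed

lemma C_on_has_derivative:
  assumes "C_on (Suc k) S f" "x \<in> S"
  shows "(f has_derivative frechet_derivative f (at x)) (at x)"
  using assms by (simp add: frechet_derivative_works)

text \<open>\<open>C_on (Suc k)\<close> speaks of derivatives only, so the base case rests on
  differentiable functions being continuous.\<close>

lemma C_on_SucD: "C_on (Suc k) S f \<Longrightarrow> C_on k S f"
proof (induction k arbitrary: f)
  case 0
  then have "\<forall>x\<in>S. f differentiable (at x)"
    by simp
  then have "f differentiable_on S"
    using differentiable_at_withinI unfolding differentiable_on_def by blast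
  then show ?case
    using differentiable_imp_continuous_on by auto
next
  case (Suc k)
  then have "\<forall>x\<in>S. f differentiable (at x)" "\<And>v. C_on k S (\<lambda>x. frechet_derivative f (at x) v)"
    by (metis C_on.simps(2))+
  then show ?case
    by simp
qed

text \<open>Derivatives are taken along the full filter \<open>at x\<close>, so being C^k near each
  point suffices, even when \<open>S\<close> is not open. In particular the property restricts from
  an open set to any subset.\<close>

lemma C_on_local:
  assumes "\<And>x. x \<in> S \<Longrightarrow> \<exists>T. open T \<and> x \<in> T \<and> C_on k T f"
  shows "C_on k S f"
  using assms
proof (induction k arbitrary: f)
  case 0
  then have "continuous (at x) f" if "x \<in> S" for x
    using that by (metis C_on.simps(1) continuous_on_eq_continuous_at)
  then show ?case
    by (simp add: continuous_at_imp_continuous_on)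
next
  case (Suc k)
  have "C_on k S (\<lambda>x. frechet_derivative f (at x) v)" for v
    by (rule Suc.IH) (metis Suc.prems C_on.simps(2))
  then show ?case
    using Suc.prems by fastforce
qed

section \<open>Closure rules for C^k functions\<close>

lemma C_on_const: "open S \<Longrightarrow> C_on k S (\<lambda>x. c)"
  by (induction k arbitrary: c)
    (auto intro!: C_on_SucI[where D = "\<lambda>_ _. 0"] simp del: C_on.simps(2))

lemma C_on_bounded_linear:
  assumes "open S" "bounded_linear L" "C_on k S f"
  shows "C_on k S (\<lambda>x. L (f x))"
  using assms(3)
proof (induction k arbitrary: f)
  case 0
  then show ?case
    by (simp add: assms(2) bounded_linear.continuous_on)
next
  case (Suc k)
  show ?case
  proof (rule C_on_SucI[OF \<open>open S\<close>])
    show "((\<lambda>x. L (f x)) has_derivative (\<lambda>v. L (frechet_derivative f (at x) v))) (at x)"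
      if "x \<in> S" for x
      using bounded_linear.has_derivative[OF assms(2) C_on_has_derivative[OF Suc.prems that]] .
    show "C_on k S (\<lambda>x. L (frechet_derivative f (at x) v))" for v
      using Suc by auto
  qed
qed

lemma C_on_ident: "open S \<Longrightarrow> C_on k S (\<lambda>x. x)"
  by (cases k)
    (auto intro!: C_on_SucI[where D = "\<lambda>_ v. v"] C_on_const simp del: C_on.simps(2))

lemma C_on_add:
  assumes "open S" "C_on k S f" "C_on k S g"
  shows "C_on k S (\<lambda>x. f x + g x)"
  using assms(2,3)
proof (induction k arbitrary: f g)
  case 0
  then show ?case
    by (simp add: continuous_on_add)
next
  case (Suc k)
  show ?case
  proof (rule C_on_SucI[OF \<open>open S\<close>])
    show "((\<lambda>x. f x + g x) has_derivative
        (\<lambda>v. frechet_derivative f (at x) v + frechet_derivative g (at x) v)) (at x)"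
      if "x \<in> S" for x
      using Suc.prems that by (intro has_derivative_add C_on_has_derivative)
    show "C_on k S (\<lambda>x. frechet_derivative f (at x) v + frechet_derivative g (at x) v)" for v
      using Suc by auto
  qed
qed

lemma C_on_sum:
  assumes "open S" "\<And>i. i \<in> I \<Longrightarrow> C_on k S (f i)"
  shows "C_on k S (\<lambda>x. \<Sum>i\<in>I. f i x)"
  using assms(2)
  by (induction I rule: infinite_finite_induct) (auto intro: C_on_add C_on_const assms(1))

text \<open>Each term of the product rule keeps one factor undifferentiated;
  \<open>C_on_SucD\<close> lowers that factor to order \<open>k\<close> for the induction
  hypothesis.\<close>

lemma C_on_scaleR:
  assumes "open S" "C_on k S f" "C_on k S g"
  shows "C_on k S (\<lambda>x. f x *\<^sub>R g x)"
  using assms(2,3)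
proof (induction k arbitrary: f g)
  case 0
  then show ?case
    by (simp add: continuous_on_scaleR)
next
  case (Suc k)
  show ?case
  proof (rule C_on_SucI[OF \<open>open S\<close>])
    show "((\<lambda>x. f x *\<^sub>R g x) has_derivative
        (\<lambda>v. f x *\<^sub>R frechet_derivative g (at x) v + frechet_derivative f (at x) v *\<^sub>R g x)) (at x)"
      if "x \<in> S" for x
      using Suc.prems that by (intro has_derivative_scaleR C_on_has_derivative)
    show "C_on k S (\<lambda>x. f x *\<^sub>R frechet_derivative g (at x) v + frechet_derivative f (at x) v *\<^sub>R g x)"
      for v
      using Suc.prems by (intro C_on_add Suc.IH \<open>open S\<close>) (auto dest: C_on_SucD simp del: C_on.simps(2), auto)
  qed
qed

section \<open>Chain rules\<close>

text \<open>The inner map has constant derivative \<open>L\<close>, so differentiating the composite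
  along \<open>v\<close> differentiates \<open>g\<close> along the fixed direction
  \<open>L v\<close> and leaves the inner map unchanged. This serves for slices of a product, whose
  chart expressions are affine.\<close>

lemma C_on_compose_affine:
  assumes "open S" "bounded_linear L" "\<And>x. x \<in> S \<Longrightarrow> c + L x \<in> T" "C_on k T g"
  shows "C_on k S (\<lambda>x. g (c + L x))"
  using assms(4)
proof (induction k arbitrary: g)
  case 0
  have "continuous_on S (\<lambda>x. c + L x)"
    using assms(2) by (intro continuous_intros linear_continuous_on)
  with 0 assms(3) show ?case
    using continuous_on_compose2[of T g S "\<lambda>x. c + L x"] by auto
next
  case (Suc k)
  show ?case
  proof (rule C_on_SucI[OF \<open>open S\<close>])
    show "((\<lambda>x. g (c + L x)) has_derivative (\<lambda>v. frechet_derivative g (at (c + L x)) (L v))) (at x)"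
      if "x \<in> S" for x
    proof (rule has_derivative_compose[where f = "\<lambda>x. c + L x"])
      show "((\<lambda>x. c + L x) has_derivative L) (at x)"
        using has_derivative_add[OF has_derivative_const bounded_linear_imp_has_derivative[OF assms(2)]]
        by simp
      show "(g has_derivative frechet_derivative g (at (c + L x))) (at (c + L x))"
        using C_on_has_derivative[OF Suc.prems assms(3)[OF that]] .
    qed
    show "C_on k S (\<lambda>x. frechet_derivative g (at (c + L x)) (L v))" for v
      using Suc.prems by (intro Suc.IH[of "\<lambda>y. frechet_derivative g (at y) (L v)"]) auto
  qed
qed

lemma orthonormal_expansion:
  fixes B :: "'e::real_inner set"
  assumes "finite B" "\<And>u v. u \<in> B \<Longrightarrow> v \<in> B \<Longrightarrow> inner u v = (if u = v then 1 else 0)"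
    and "x \<in> span B"
  shows "(\<Sum>b\<in>B. inner x b *\<^sub>R b) = x"
  using assms
  by (intro orthonormal_basis_expand)
    (auto simp: pairwise_def orthogonal_def norm_eq_sqrt_inner)

text \<open>The induction varies \<open>g\<close> and keeps \<open>f\<close>. The finite basis
  belongs to the middle space, where the moving direction of differentiation is expanded.\<close>

lemma C_on_compose:
  fixes g :: "'b::real_inner \<Rightarrow> 'c::real_normed_vector"
  assumes "has_finite_orthonormal_basis TYPE('b)"
    and "open S" "f ` S \<subseteq> T" "C_on k S f" "C_on k T g"
  shows "C_on k S (\<lambda>x. g (f x))"
proof -
  obtain B :: "'b set" where B: "finite B" "\<And>u v. u \<in> B \<Longrightarrow> v \<in> B \<Longrightarrow> inner u v = (if u = v then 1 else 0)"
      "span B = UNIV"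
    using assms(1) unfolding has_finite_orthonormal_basis_def by blast
  show ?thesis
    using assms(4,5)
  proof (induction k arbitrary: g)
    case 0
    with assms(3) show ?case
      by (simp add: continuous_on_compose2)
  next
    case (Suc k)
    define f' where "f' x = frechet_derivative f (at x)" for x
    define g' where "g' y = frechet_derivative g (at y)" for y
    have f': "(f has_derivative f' x) (at x)" and g': "(g has_derivative g' (f x)) (at (f x))"
      if "x \<in> S" for x
      using C_on_has_derivative that Suc.prems assms(3) unfolding f'_def g'_def by blast+
    show ?case
    proof (rule C_on_SucI[OF \<open>open S\<close>])
      \<comment> \<open>Expanding \<open>f' x v\<close> in the basis leaves \<open>g'\<close> applied to fixed directions only, which is what
        the induction hypothesis covers.\<close>
      show "((\<lambda>x. g (f x)) has_derivative (\<lambda>v. \<Sum>b\<in>B. inner (f' x v) b *\<^sub>R g' (f x) b)) (at x)"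
        if "x \<in> S" for x
      proof -
        have lin: "linear (g' (f x))"
          using g'[OF that] has_derivative_linear by blast
        have "g' (f x) (f' x v) = (\<Sum>b\<in>B. inner (f' x v) b *\<^sub>R g' (f x) b)" for v
          using arg_cong[OF orthonormal_expansion[OF B(1,2), of "f' x v"], of "g' (f x)"] B(3)
          by (simp add: linear_sum[OF lin] linear_cmul[OF lin])
        with has_derivative_compose[OF f'[OF that] g'[OF that]] show ?thesis
          by simp
      qed
      show "C_on k S (\<lambda>x. \<Sum>b\<in>B. inner (f' x v) b *\<^sub>R g' (f x) b)" for v
      proof (intro C_on_sum C_on_scaleR \<open>open S\<close>)
        fix b
        show "C_on k S (\<lambda>x. inner (f' x v) b)"
          using Suc.prems(1) unfolding f'_def
          by (intro C_on_bounded_linear[OF \<open>open S\<close> bounded_linear_inner_left]) auto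
        show "C_on k S (\<lambda>x. g' (f x) b)"
          using Suc.prems by (intro Suc.IH[of "\<lambda>y. g' y b"]) (auto dest: C_on_SucD simp: g'_def simp del: C_on.simps(2), auto)
      qed
    qed
  qed
qed

section \<open>Smooth maps\<close>

lemma manifold_charts:
  assumes "smooth_manifold M" "(U, \<phi>) \<in> charts M"
  shows openin_chart: "openin (topo M) U"
    and open_chart_image: "openin (topo M) V \<Longrightarrow> V \<subseteq> U \<Longrightarrow> open (\<phi> ` V)"
    and inj_on_chart: "inj_on \<phi> U"
    and chart_subset: "U \<subseteq> points M"
proof -
  have c: "openin (topo M) U" "open (\<phi> ` U)"
      "homeomorphic_map (subtopology (topo M) U) (top_of_set (\<phi> ` U)) \<phi>"
    using assms unfolding smooth_manifold_def by blast+
  show "openin (topo M) U" by fact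
  then show sub: "U \<subseteq> points M"
    by (rule openin_subset)
  show "inj_on \<phi> U"
    using homeomorphic_imp_injective_map[OF c(3)] sub by (simp add: Int_absorb1)
  show "open (\<phi> ` V)" if "openin (topo M) V" "V \<subseteq> U"
  proof -
    have "openin (subtopology (topo M) U) V"
      using that by (simp add: openin_open_subtopology c(1))
    then have "openin (top_of_set (\<phi> ` U)) (\<phi> ` V)"
      using c(3) homeomorphic_imp_open_map open_map_def by blast
    then show ?thesis
      using c(2) openin_open_trans by blast
  qed
qed

lemma chart_at:
  assumes "smooth_manifold M" "x \<in> points M"
  obtains U \<phi> where "(U, \<phi>) \<in> charts M" "x \<in> U"
proof -
  have "x \<in> (\<Union>(U, \<phi>)\<in>charts M. U)"
    using assms by (simp add: smooth_manifold_def)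
  then show thesis
    using that by auto
qed

text \<open>Smoothness is local: a neighbourhood of each chart point suffices, and it may depend on
  \<open>k\<close>.\<close>

lemma smooth_mapI:
  assumes "continuous_map (topo M) (topo N) h"
    and "\<And>U \<phi> W \<psi> x k. (U, \<phi>) \<in> charts M \<Longrightarrow> (W, \<psi>) \<in> charts N \<Longrightarrow> x \<in> U \<Longrightarrow> h x \<in> W \<Longrightarrow>
      \<exists>S. open S \<and> \<phi> x \<in> S \<and> C_on k S (\<lambda>y. \<psi> (h (inv_into U \<phi> y)))"
  shows "smooth_map M N h"
proof -
  have "C_on k (\<phi> ` (U \<inter> h -` W)) (\<lambda>y. \<psi> (h (inv_into U \<phi> y)))"
    if "(U, \<phi>) \<in> charts M" "(W, \<psi>) \<in> charts N" for U \<phi> W \<psi> k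
    by (rule C_on_local) (use assms(2)[OF that] in blast)
  then show ?thesis
    using assms(1) by (auto simp: smooth_map_def smooth_on_def)
qed

lemma smooth_map_continuous: "smooth_map M N h \<Longrightarrow> continuous_map (topo M) (topo N) h"
  by (simp add: smooth_map_def)

lemma smooth_map_closed: "smooth_map M N h \<Longrightarrow> x \<in> points M \<Longrightarrow> h x \<in> points N"
  by (auto simp: smooth_map_def continuous_map_def)

lemma smooth_map_C_on:
  assumes "smooth_map M N h" "(U, \<phi>) \<in> charts M" "(W, \<psi>) \<in> charts N"
  shows "C_on k (\<phi> ` (U \<inter> h -` W)) (\<lambda>y. \<psi> (h (inv_into U \<phi> y)))"
  using assms unfolding smooth_map_def smooth_on_def by blast

lemma openin_preimage:
  assumes "smooth_map M N h" "openin (topo M) U" "openin (topo N) W"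
  shows "openin (topo M) (U \<inter> h -` W)"
proof -
  have "U \<inter> h -` W = {x \<in> U. h x \<in> W}"
    by auto
  then show ?thesis
    using openin_continuous_map_preimage_gen[OF smooth_map_continuous[OF assms(1)] assms(2,3)] by simp
qed

text \<open>Charts see only points of \<open>M\<close>. This passes from a composite to a map given
  by cases with a default value off \<open>M\<close>.\<close>

lemma smooth_map_cong:
  assumes "smooth_manifold M" "smooth_manifold N"
    and eq: "\<And>x. x \<in> points M \<Longrightarrow> h x = h' x" and h: "smooth_map M N h"
  shows "smooth_map M N h'"
proof (rule smooth_mapI)
  show "continuous_map (topo M) (topo N) h'"
    using continuous_map_eq[OF smooth_map_continuous[OF h] eq] .
next
  fix U \<phi> W \<psi> x k
  assume c: "(U, \<phi>) \<in> charts M" "(W, \<psi>) \<in> charts N" and x: "x \<in> U" "h' x \<in> W"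
  note sub = chart_subset[OF assms(1) c(1)]
  let ?S = "\<phi> ` (U \<inter> h -` W)"
  have op: "open ?S"
    using openin_preimage[OF h openin_chart[OF assms(1) c(1)] openin_chart[OF assms(2) c(2)]]
    by (intro open_chart_image[OF assms(1) c(1)]) auto
  have "C_on k ?S (\<lambda>y. \<psi> (h' (inv_into U \<phi> y)))"
  proof (rule C_on_cong[OF op _ smooth_map_C_on[OF h c]])
    fix y assume "y \<in> ?S"
    then have "inv_into U \<phi> y \<in> U"
      by (auto intro: inv_into_into)
    with eq sub show "\<psi> (h (inv_into U \<phi> y)) = \<psi> (h' (inv_into U \<phi> y))"
      by auto
  qed
  moreover have "\<phi> x \<in> ?S"
    using x eq sub by auto
  ultimately show "\<exists>S. open S \<and> \<phi> x \<in> S \<and> C_on k S (\<lambda>y. \<psi> (h' (inv_into U \<phi> y)))"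
    using op by blast
qed

text \<open>Near \<open>x\<close> the chart expression of the composite factors through a chart of
  \<open>N\<close> at \<open>f x\<close>, once the domain is shrunk to the points that
  \<open>f\<close> sends into that chart and into the preimage of \<open>W\<close>.\<close>

lemma smooth_map_compose:
  fixes N :: "('n, 'f::real_inner) manifold"
  assumes M: "smooth_manifold M" and N: "smooth_manifold N" and K: "smooth_manifold K"
    and f: "smooth_map M N f" and g: "smooth_map N K g"
  shows "smooth_map M K (\<lambda>x. g (f x))"
proof (rule smooth_mapI)
  show "continuous_map (topo M) (topo K) (\<lambda>x. g (f x))"
    using continuous_map_compose[OF smooth_map_continuous[OF f] smooth_map_continuous[OF g]]
    by (simp add: o_def)
next
  fix U \<phi> W \<psi> x k
  assume c: "(U, \<phi>) \<in> charts M" "(W, \<psi>) \<in> charts K" and x: "x \<in> U" "g (f x) \<in> W"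
  have "f x \<in> points N"
    using smooth_map_closed[OF f] x(1) chart_subset[OF M c(1)] by auto
  then obtain V \<kappa> where V: "(V, \<kappa>) \<in> charts N" "f x \<in> V"
    using chart_at[OF N] by blast
  let ?T = "V \<inter> g -` W"
  let ?S = "\<phi> ` (U \<inter> f -` ?T)"
  have T: "openin (topo N) ?T"
    using openin_preimage[OF g openin_chart[OF N V(1)] openin_chart[OF K c(2)]] .
  have op: "open (\<phi> ` (U \<inter> f -` Z))" if "openin (topo N) Z" for Z
    using openin_preimage[OF f openin_chart[OF M c(1)] that]
    by (intro open_chart_image[OF M c(1)]) auto
  \<comment> \<open>Smoothness of \<open>f\<close> gives this on the larger open set coming from
    \<open>V\<close> alone; locality restricts it to \<open>?S\<close>.\<close>
  have f1: "C_on k ?S (\<lambda>y. \<kappa> (f (inv_into U \<phi> y)))"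
  proof (rule C_on_local)
    show "\<exists>Z. open Z \<and> y \<in> Z \<and> C_on k Z (\<lambda>y. \<kappa> (f (inv_into U \<phi> y)))" if "y \<in> ?S" for y
      using that op[OF openin_chart[OF N V(1)]] smooth_map_C_on[OF f c(1) V(1)] by blast
  qed
  have inv: "inv_into U \<phi> y \<in> U \<inter> f -` ?T" if "y \<in> ?S" for y
    using that inv_into_f_f[OF inj_on_chart[OF M c(1)]] by auto
  have "C_on k ?S (\<lambda>y. \<psi> (g (inv_into V \<kappa> (\<kappa> (f (inv_into U \<phi> y))))))"
  proof (rule C_on_compose[OF _ op[OF T] _ f1 smooth_map_C_on[OF g V(1) c(2)]])
    show "has_finite_orthonormal_basis TYPE('f)"
      using N by (simp add: smooth_manifold_def)
    show "(\<lambda>y. \<kappa> (f (inv_into U \<phi> y))) ` ?S \<subseteq> \<kappa> ` ?T"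
      using inv by auto
  qed
  \<comment> \<open>On \<open>?S\<close> the values of \<open>f\<close> lie in \<open>V\<close>, so
    the inserted chart \<open>\<kappa>\<close> cancels against its inverse.\<close>
  then have "C_on k ?S (\<lambda>y. \<psi> (g (f (inv_into U \<phi> y))))"
    by (rule C_on_cong[OF op[OF T], rotated])
      (use inv inv_into_f_f[OF inj_on_chart[OF N V(1)]] in auto)
  moreover have "\<phi> x \<in> ?S"
    using x V by auto
  ultimately show "\<exists>S. open S \<and> \<phi> x \<in> S \<and> C_on k S (\<lambda>y. \<psi> (g (f (inv_into U \<phi> y))))"
    using op[OF T] by blast
qed

section \<open>Freezing one argument of a map on a product\<close>

text \<open>In a product chart around \<open>c\<close> the inclusion of the slice is the affine map
  sending \<open>y\<close> to \<open>(\<kappa> c, 0) + (0, y)\<close>, so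
  \<open>C_on_compose_affine\<close> applies. The product enters only through its topology and
  charts.\<close>

lemma smooth_map_slice_right:
  assumes M: "smooth_manifold M" and N: "smooth_manifold N" and K: "smooth_manifold K"
    and F: "smooth_map (prod_manifold M N) K F" and c: "c \<in> points M"
  shows "smooth_map N K (\<lambda>y. F (c, y))"
proof (rule smooth_mapI)
  show cont: "continuous_map (topo N) (topo K) (\<lambda>y. F (c, y))"
    using continuous_map_compose[OF _ smooth_map_continuous[OF F], of "topo N" "\<lambda>y. (c, y)"] c
    by (simp add: o_def prod_manifold_def continuous_map_pairwise)
  fix U \<phi> W \<psi> x k
  assume ch: "(U, \<phi>) \<in> charts N" "(W, \<psi>) \<in> charts K" and x: "x \<in> U" "F (c, x) \<in> W"
  obtain V \<kappa> where V: "(V, \<kappa>) \<in> charts M" "c \<in> V"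
    using chart_at[OF M c] by blast
  let ?P = "V \<times> U" and ?h = "map_prod \<kappa> \<phi>"
  have P: "(?P, ?h) \<in> charts (prod_manifold M N)"
    using V(1) ch(1) by (auto simp: prod_manifold_def)
  have inj: "inj_on ?h ?P"
    using inj_on_chart[OF M V(1)] inj_on_chart[OF N ch(1)] by (intro map_prod_inj_on)
  let ?S = "\<phi> ` {y \<in> U. F (c, y) \<in> W}"
  have "openin (topo N) {y \<in> U. F (c, y) \<in> W}"
    using openin_continuous_map_preimage_gen[OF cont openin_chart[OF N ch(1)] openin_chart[OF K ch(2)]] .
  then have op: "open ?S"
    by (intro open_chart_image[OF N ch(1)]) auto
  have "C_on k ?S (\<lambda>y. \<psi> (F (inv_into ?P ?h ((\<kappa> c, 0) + (0, y)))))"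
  proof (rule C_on_compose_affine[OF op _ _ smooth_map_C_on[OF F P ch(2)]])
    show "bounded_linear (\<lambda>y. (0, y))"
      by (intro bounded_linear_Pair bounded_linear_zero bounded_linear_ident)
    show "(\<kappa> c, 0) + (0, y) \<in> ?h ` (?P \<inter> F -` W)" if "y \<in> ?S" for y
      using that V(2) by force
  qed
  then have "C_on k ?S (\<lambda>y. \<psi> (F (c, inv_into U \<phi> y)))"
  proof (rule C_on_cong[OF op, rotated])
    fix y assume "y \<in> ?S"
    then obtain z where z: "z \<in> U" "y = \<phi> z"
      by auto
    then show "\<psi> (F (inv_into ?P ?h ((\<kappa> c, 0) + (0, y)))) = \<psi> (F (c, inv_into U \<phi> y))"
      using inv_into_f_f[OF inj, of "(c, z)"] inv_into_f_f[OF inj_on_chart[OF N ch(1)]] V(2) by simp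
  qed
  moreover have "\<phi> x \<in> ?S"
    using x by auto
  ultimately show "\<exists>S. open S \<and> \<phi> x \<in> S \<and> C_on k S (\<lambda>y. \<psi> (F (c, inv_into U \<phi> y)))"
    using op by blast
qed

lemma smooth_map_slice_left:
  assumes M: "smooth_manifold M" and N: "smooth_manifold N" and K: "smooth_manifold K"
    and F: "smooth_map (prod_manifold M N) K F" and c: "c \<in> points N"
  shows "smooth_map M K (\<lambda>x. F (x, c))"
proof (rule smooth_mapI)
  show cont: "continuous_map (topo M) (topo K) (\<lambda>x. F (x, c))"
    using continuous_map_compose[OF _ smooth_map_continuous[OF F], of "topo M" "\<lambda>x. (x, c)"] c
    by (simp add: o_def prod_manifold_def continuous_map_pairwise)
  fix U \<phi> W \<psi> x k
  assume ch: "(U, \<phi>) \<in> charts M" "(W, \<psi>) \<in> charts K" and x: "x \<in> U" "F (x, c) \<in> W"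
  obtain V \<kappa> where V: "(V, \<kappa>) \<in> charts N" "c \<in> V"
    using chart_at[OF N c] by blast
  let ?P = "U \<times> V" and ?h = "map_prod \<phi> \<kappa>"
  have P: "(?P, ?h) \<in> charts (prod_manifold M N)"
    using V(1) ch(1) by (auto simp: prod_manifold_def)
  have inj: "inj_on ?h ?P"
    using inj_on_chart[OF M ch(1)] inj_on_chart[OF N V(1)] by (intro map_prod_inj_on)
  let ?S = "\<phi> ` {y \<in> U. F (y, c) \<in> W}"
  have "openin (topo M) {y \<in> U. F (y, c) \<in> W}"
    using openin_continuous_map_preimage_gen[OF cont openin_chart[OF M ch(1)] openin_chart[OF K ch(2)]] .
  then have op: "open ?S"
    by (intro open_chart_image[OF M ch(1)]) auto
  have "C_on k ?S (\<lambda>y. \<psi> (F (inv_into ?P ?h ((0, \<kappa> c) + (y, 0)))))"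
  proof (rule C_on_compose_affine[OF op _ _ smooth_map_C_on[OF F P ch(2)]])
    show "bounded_linear (\<lambda>y. (y, 0))"
      by (intro bounded_linear_Pair bounded_linear_zero bounded_linear_ident)
    show "(0, \<kappa> c) + (y, 0) \<in> ?h ` (?P \<inter> F -` W)" if "y \<in> ?S" for y
      using that V(2) by force
  qed
  then have "C_on k ?S (\<lambda>y. \<psi> (F (inv_into U \<phi> y, c)))"
  proof (rule C_on_cong[OF op, rotated])
    fix y assume "y \<in> ?S"
    then obtain z where z: "z \<in> U" "y = \<phi> z"
      by auto
    then show "\<psi> (F (inv_into ?P ?h ((0, \<kappa> c) + (y, 0)))) = \<psi> (F (inv_into U \<phi> y, c))"
      using inv_into_f_f[OF inj, of "(z, c)"] inv_into_f_f[OF inj_on_chart[OF M ch(1)]] V(2) by simp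
  qed
  moreover have "\<phi> x \<in> ?S"
    using x by auto
  ultimately show "\<exists>S. open S \<and> \<phi> x \<in> S \<and> C_on k S (\<lambda>y. \<psi> (F (inv_into U \<phi> y, c)))"
    using op by blast
qed

text \<open>This makes composing a real function with a smooth map an instance of
  \<open>smooth_map_compose\<close>.\<close>

lemma smooth_manifold_real_line: "smooth_manifold real_line"
proof -
  have "span {1::real} = UNIV"
    by (simp add: span_singleton)
  then have "has_finite_orthonormal_basis TYPE(real)"
    unfolding has_finite_orthonormal_basis_def by (intro exI[of _ "{1}"]) simp
  moreover have "second_countable (euclidean :: real topology)"
  proof -
    obtain B :: "real set set" where "countable B" "topological_basis B"
      using ex_countable_basis by blast
    then show ?thesis
      unfolding second_countable_def
      by (metis open_openin topological_basisE topological_basis_open)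
  qed
  moreover have "smooth_on UNIV (id :: real \<Rightarrow> real)"
    by (simp add: smooth_on_def C_on_ident id_def)
  ultimately show ?thesis
    by (simp add: smooth_manifold_def real_line_def inv_id)
qed

section \<open>Smooth functions and tangent maps\<close>

lemma smooth_map_real_line_iff:
  "smooth_map M real_line p \<longleftrightarrow> continuous_map (topo M) euclidean p \<and>
    (\<forall>(U, \<phi>)\<in>charts M. \<forall>k. C_on k (\<phi> ` U) (\<lambda>y. p (inv_into U \<phi> y)))"
  by (auto simp: smooth_map_def real_line_def smooth_on_def)

lemma smooth_functions_mult:
  assumes M: "smooth_manifold M" and p: "p \<in> smooth_functions M" and q: "q \<in> smooth_functions M"
  shows "(\<lambda>y. p y * q y) \<in> smooth_functions M"
proof -
  have "C_on k (\<phi> ` U) (\<lambda>y. p (inv_into U \<phi> y) * q (inv_into U \<phi> y))" if "(U, \<phi>) \<in> charts M" for U \<phi> k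
    using that p q open_chart_image[OF M that openin_chart[OF M that]]
    unfolding smooth_functions_def smooth_map_real_line_iff
    by (intro C_on_scaleR[where 'b = real, simplified]) auto
  moreover have "continuous_map (topo M) euclidean (\<lambda>y. p y * q y)"
    using p q by (intro continuous_map_real_mult) (auto simp: smooth_functions_def smooth_map_real_line_iff)
  ultimately show ?thesis
    using p by (auto simp: smooth_functions_def smooth_map_real_line_iff)
qed

lemma smooth_functions_linear:
  assumes M: "smooth_manifold M" and p: "p \<in> smooth_functions M" and q: "q \<in> smooth_functions M"
  shows "(\<lambda>y. a * p y + b * q y) \<in> smooth_functions M"
proof -
  have "C_on k (\<phi> ` U) (\<lambda>y. a * p (inv_into U \<phi> y) + b * q (inv_into U \<phi> y))"
    if "(U, \<phi>) \<in> charts M" for U \<phi> k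
    using that p q open_chart_image[OF M that openin_chart[OF M that]]
    unfolding smooth_functions_def smooth_map_real_line_iff
    by (intro C_on_add C_on_bounded_linear[OF _ bounded_linear_mult_right]) auto
  moreover have "continuous_map (topo M) euclidean (\<lambda>y. a * p y + b * q y)"
    using p q by (intro continuous_map_add continuous_map_real_mult)
      (auto simp: smooth_functions_def smooth_map_real_line_iff)
  ultimately show ?thesis
    using p q by (auto simp: smooth_functions_def smooth_map_real_line_iff)
qed

section \<open>Pullback of functions and functoriality of tangent maps\<close>

text \<open>This is the argument on which \<open>tangent_map\<close> evaluates \<open>v\<close>; the
  value off \<open>M\<close> is the one that \<open>smooth_functions M\<close> demands.\<close>

definition pullback :: "('m, 'e) manifold \<Rightarrow> ('m \<Rightarrow> 'n) \<Rightarrow> ('n \<Rightarrow> real) \<Rightarrow> 'm \<Rightarrow> real"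
  where "pullback M h p = (\<lambda>y. if y \<in> points M then p (h y) else 0)"

lemma pullback_smooth_functions:
  assumes "smooth_manifold M" "smooth_manifold N" "smooth_map M N h" "p \<in> smooth_functions N"
  shows "pullback M h p \<in> smooth_functions M"
proof -
  have "smooth_map M real_line (\<lambda>x. p (h x))"
    using smooth_map_compose[OF assms(1,2) smooth_manifold_real_line assms(3)] assms(4)
    by (simp add: smooth_functions_def)
  then have "smooth_map M real_line (pullback M h p)"
    by (rule smooth_map_cong[OF assms(1) smooth_manifold_real_line, rotated])
      (simp add: pullback_def)
  then show ?thesis
    by (simp add: smooth_functions_def pullback_def)
qed

lemma tangent_map_pullback:
  "tangent_map M N h v = (\<lambda>p. if p \<in> smooth_functions N then v (pullback M h p) else 0)"
  unfolding tangent_map_def pullback_def ..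

text \<open>Pullback is an algebra homomorphism that turns evaluation at \<open>h x\<close> into
  evaluation at \<open>x\<close>, so a derivation at \<open>x\<close> becomes one at
  \<open>h x\<close>.\<close>

lemma tangent_map_tangent_space:
  assumes M: "smooth_manifold M" and N: "smooth_manifold N" and h: "smooth_map M N h"
    and x: "x \<in> points M" and v: "v \<in> tangent_space M x"
  shows "tangent_map M N h v \<in> tangent_space N (h x)"
proof -
  have lin: "pullback M h (\<lambda>y. a * p y + b * q y) = (\<lambda>y. a * pullback M h p y + b * pullback M h q y)"
    and mult: "pullback M h (\<lambda>y. p y * q y) = (\<lambda>y. pullback M h p y * pullback M h q y)"
    for a b p q
    by (auto simp: pullback_def)
  have at: "pullback M h p x = p (h x)" for p
    using x by (simp add: pullback_def)
  show ?thesis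
    using v pullback_smooth_functions[OF M N h] smooth_functions_linear[OF N] smooth_functions_mult[OF N]
    by (simp add: tangent_space_def tangent_map_pullback lin mult at)
qed

text \<open>Pullback reverses composition: since \<open>k\<close> undoes \<open>h\<close> on
  \<open>M\<close>, pulling \<open>p\<close> back along \<open>k\<close> and then along
  \<open>h\<close> returns \<open>p\<close>.\<close>

lemma tangent_map_inverse:
  assumes M: "smooth_manifold M" and N: "smooth_manifold N" and h: "smooth_map M N h"
    and k: "smooth_map N M k" and kh: "\<And>y. y \<in> points M \<Longrightarrow> k (h y) = y"
    and v: "v \<in> tangent_space M x"
  shows "tangent_map N M k (tangent_map M N h v) = v"
proof
  fix p
  show "tangent_map N M k (tangent_map M N h v) p = v p"
  proof (cases "p \<in> smooth_functions M")
    case True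
    \<comment> \<open>On \<open>M\<close> the inner default is never reached because
      \<open>h\<close> maps into \<open>N\<close>; off \<open>M\<close> both sides are 0.\<close>
    then have "pullback M h (pullback N k p) = p"
      using kh smooth_map_closed[OF h] by (auto simp: pullback_def smooth_functions_def)
    with True show ?thesis
      using pullback_smooth_functions[OF N M k] by (simp add: tangent_map_pullback)
  next
    \<comment> \<open>Both sides take the default value 0 of tangent vectors.\<close>
    case False
    with v show ?thesis
      by (simp add: tangent_map_pullback tangent_space_def)
  qed
qed

section \<open>Smooth actions of Lie groups\<close>

locale lie_group_action =
  fixes G :: "('g, 'a::real_inner) lie_group_data"
    and M :: "('m, 'b::real_inner) manifold"
    and act :: "'g \<Rightarrow> 'm \<Rightarrow> 'm"
  assumes lie_group: "lie_group G"
    and smooth_manifold: "smooth_manifold M"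
    and smooth_action: "smooth_transitive_action G M act"
begin

sublocale group G
  using lie_group by (simp add: lie_group_def)

sublocale action: group_action G "points M" act
  using smooth_action by (simp add: smooth_transitive_action_def transitive_action_def)

lemma smooth_manifold_group: "smooth_manifold (manifold_of G)"
  and points_group: "points (manifold_of G) = carrier G"
  using lie_group by (auto simp: lie_group_def)

lemma act_closed: "g \<in> carrier G \<Longrightarrow> x \<in> points M \<Longrightarrow> act g x \<in> points M"
  using action.element_image by blast

lemma act_inv_act: "g \<in> carrier G \<Longrightarrow> x \<in> points M \<Longrightarrow> act (inv\<^bsub>G\<^esub> g) (act g x) = x"
  using action.orbit_sym_aux by blast

lemma act_act_inv: "g \<in> carrier G \<Longrightarrow> x \<in> points M \<Longrightarrow> act g (act (inv\<^bsub>G\<^esub> g) x) = x"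
  using act_inv_act[of "inv\<^bsub>G\<^esub> g" x] by simp

lemma bij_betw_act: "g \<in> carrier G \<Longrightarrow> bij_betw (act g) (points M) (points M)"
  using action.inj_prop action.surj_prop by (simp add: bij_betw_def)

lemma act_smooth: "g \<in> carrier G \<Longrightarrow> smooth_map M M (act g)"
  using smooth_map_slice_right[OF smooth_manifold_group smooth_manifold smooth_manifold,
      of "\<lambda>(g, x). act g x" g] smooth_action
  by (simp add: smooth_transitive_action_def points_group)

section \<open>The adjoint action\<close>

text \<open>Conjugation is a left translation followed by a right translation, each a slice of the
  multiplication.\<close>

lemma conjugation_smooth:
  assumes g: "g \<in> carrier G"
  shows "smooth_map (manifold_of G) (manifold_of G) (\<lambda>h. g \<otimes>\<^bsub>G\<^esub> h \<otimes>\<^bsub>G\<^esub> inv\<^bsub>G\<^esub> g)"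
proof -
  note m = smooth_manifold_group
  have mult: "smooth_map (prod_manifold (manifold_of G) (manifold_of G)) (manifold_of G)
      (\<lambda>(g, h). g \<otimes>\<^bsub>G\<^esub> h)"
    using lie_group by (simp add: lie_group_def)
  have "smooth_map (manifold_of G) (manifold_of G) (\<lambda>h. g \<otimes>\<^bsub>G\<^esub> h)"
    using smooth_map_slice_right[OF m m m mult] g by (simp add: points_group)
  moreover have "smooth_map (manifold_of G) (manifold_of G) (\<lambda>h. h \<otimes>\<^bsub>G\<^esub> inv\<^bsub>G\<^esub> g)"
    using smooth_map_slice_left[OF m m m mult] g by (simp add: points_group)
  ultimately show ?thesis
    by (rule smooth_map_compose[OF m m m])
qed

text \<open>Conjugation fixes 1, so its tangent map carries the tangent space at 1 into
  itself.\<close>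

lemma Ad_closed:
  assumes "g \<in> carrier G" "\<xi> \<in> lie_algebra G"
  shows "Ad G g \<xi> \<in> lie_algebra G"
  using tangent_map_tangent_space[OF smooth_manifold_group smooth_manifold_group
      conjugation_smooth[OF assms(1)], of "\<one>\<^bsub>G\<^esub>" \<xi>] assms
  by (simp add: Ad_def lie_algebra_def points_group)

lemma Ad_inv_Ad:
  assumes g: "g \<in> carrier G" and \<xi>: "\<xi> \<in> lie_algebra G"
  shows "Ad G (inv\<^bsub>G\<^esub> g) (Ad G g \<xi>) = \<xi>"
  unfolding Ad_def
proof (rule tangent_map_inverse[OF smooth_manifold_group smooth_manifold_group])
  show "inv\<^bsub>G\<^esub> g \<otimes>\<^bsub>G\<^esub> (g \<otimes>\<^bsub>G\<^esub> h \<otimes>\<^bsub>G\<^esub> inv\<^bsub>G\<^esub> g) \<otimes>\<^bsub>G\<^esub> inv\<^bsub>G\<^esub> (inv\<^bsub>G\<^esub> g) = h"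
    if "h \<in> points (manifold_of G)" for h
    using that g by (simp add: points_group m_assoc inv_solve_left')
  show "\<xi> \<in> tangent_space (manifold_of G) \<one>\<^bsub>G\<^esub>"
    using \<xi> by (simp add: lie_algebra_def)
qed (rule conjugation_smooth, use g in simp)+

lemma Ad_linear:
  "Ad G g (\<lambda>p. a * \<xi> p + b * \<eta> p) = (\<lambda>p. a * Ad G g \<xi> p + b * Ad G g \<eta> p)"
  by (auto simp: Ad_def tangent_map_def)

section \<open>Translates of Lie algebra valued maps and of vector fields\<close>

text \<open>If \<open>l\<close> is a linear functional on the Lie algebra, so is \<open>l\<close>
  after \<open>Ad G g\<close>. Smoothness of \<open>\<nu>\<close> tested against this new
  functional, followed by composition with the action of the inverse of \<open>g\<close>, gives the
  claim for \<open>l\<close>.\<close>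

lemma act_lie_map_closed:
  assumes g: "g \<in> carrier G" and \<nu>: "\<nu> \<in> smooth_lie_maps G M"
  shows "act_lie_map G M act g \<nu> \<in> smooth_lie_maps G M"
proof -
  have \<nu>_lie: "\<nu> x \<in> lie_algebra G" if "x \<in> points M" for x
    using \<nu> that by (simp add: smooth_lie_maps_def)
  have "smooth_map M real_line (\<lambda>x. l (act_lie_map G M act g \<nu> x))"
    if l: "\<forall>\<xi>\<in>lie_algebra G. \<forall>\<eta>\<in>lie_algebra G. \<forall>a b.
             l (\<lambda>p. a * \<xi> p + b * \<eta> p) = a * l \<xi> + b * l \<eta>" for l :: "'g tangent \<Rightarrow> real"
  proof -
    have "\<forall>\<xi>\<in>lie_algebra G. \<forall>\<eta>\<in>lie_algebra G. \<forall>a b.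
        l (Ad G g (\<lambda>p. a * \<xi> p + b * \<eta> p)) = a * l (Ad G g \<xi>) + b * l (Ad G g \<eta>)"
      using l Ad_closed[OF g] by (simp add: Ad_linear)
    then have "smooth_map M real_line (\<lambda>x. l (Ad G g (\<nu> x)))"
      using \<nu> unfolding smooth_lie_maps_def by (auto dest: spec[of _ "\<lambda>\<xi>. l (Ad G g \<xi>)"])
    then have "smooth_map M real_line (\<lambda>x. l (Ad G g (\<nu> (act (inv\<^bsub>G\<^esub> g) x))))"
      using smooth_map_compose[OF smooth_manifold smooth_manifold smooth_manifold_real_line
          act_smooth[of "inv\<^bsub>G\<^esub> g"]] g by simp
    then show ?thesis
      by (rule smooth_map_cong[OF smooth_manifold smooth_manifold_real_line, rotated])
        (simp add: act_lie_map_def)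
  qed
  with g \<nu>_lie show ?thesis
    by (auto simp: smooth_lie_maps_def act_lie_map_def intro!: Ad_closed act_closed)
qed

lemma act_lie_map_act:
  assumes "g \<in> carrier G" "x \<in> points M"
  shows "act_lie_map G M act g \<nu> (act g x) = Ad G g (\<nu> x)"
  using assms by (simp add: act_lie_map_def act_closed act_inv_act)

lemma act_lie_map_inv:
  assumes g: "g \<in> carrier G" and \<nu>: "\<nu> \<in> smooth_lie_maps G M"
  shows "act_lie_map G M act (inv\<^bsub>G\<^esub> g) (act_lie_map G M act g \<nu>) = \<nu>"
proof
  fix x
  show "act_lie_map G M act (inv\<^bsub>G\<^esub> g) (act_lie_map G M act g \<nu>) x = \<nu> x"
  proof (cases "x \<in> points M")
    case True
    then have "\<nu> x \<in> lie_algebra G"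
      using \<nu> by (simp add: smooth_lie_maps_def)
    then show ?thesis
      using True g act_lie_map_act[OF g True] by (simp add: act_lie_map_def[of _ _ _ "inv\<^bsub>G\<^esub> g"] Ad_inv_Ad)
  next
    case False
    with \<nu> show ?thesis
      by (simp add: smooth_lie_maps_def act_lie_map_def)
  qed
qed

text \<open>At \<open>p\<close> the translated field is \<open>f (act (inv g) x)\<close> evaluated
  on the pullback of \<open>p\<close> along \<open>act g\<close>. That test function does not vary
  with \<open>x\<close>, so smoothness of \<open>f\<close> applies to it; the base point is right
  because \<open>g\<close> sends \<open>act (inv g) x\<close> back to \<open>x\<close>.\<close>

lemma act_field_closed:
  assumes g: "g \<in> carrier G" and f: "f \<in> vector_fields M"
  shows "act_field G M act g f \<in> vector_fields M"
proof -
  have "act_field G M act g f x \<in> tangent_space M x" if x: "x \<in> points M" for x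
  proof -
    have y: "act (inv\<^bsub>G\<^esub> g) x \<in> points M"
      using x g by (simp add: act_closed)
    then have "f (act (inv\<^bsub>G\<^esub> g) x) \<in> tangent_space M (act (inv\<^bsub>G\<^esub> g) x)"
      using f by (simp add: vector_fields_def)
    from tangent_map_tangent_space[OF smooth_manifold smooth_manifold act_smooth[OF g] y this]
    show ?thesis
      using x g by (simp add: act_field_def act_act_inv)
  qed
  moreover have "smooth_map M real_line (\<lambda>x. act_field G M act g f x p)"
    if p: "p \<in> smooth_functions M" for p
  proof -
    have "smooth_map M real_line (\<lambda>x. f x (pullback M (act g) p))"
      using f pullback_smooth_functions[OF smooth_manifold smooth_manifold act_smooth[OF g] p]
      by (simp add: vector_fields_def)
    then have "smooth_map M real_line (\<lambda>x. f (act (inv\<^bsub>G\<^esub> g) x) (pullback M (act g) p))"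
      using smooth_map_compose[OF smooth_manifold smooth_manifold smooth_manifold_real_line
          act_smooth[of "inv\<^bsub>G\<^esub> g"]] g by simp
    then show ?thesis
      by (rule smooth_map_cong[OF smooth_manifold smooth_manifold_real_line, rotated])
        (simp add: act_field_def tangent_map_pullback p)
  qed
  ultimately show ?thesis
    by (simp add: vector_fields_def act_field_def)
qed

text \<open>On \<open>M\<close> the map \<open>h'\<close> is the conjugate of \<open>h\<close> by
  \<open>g\<close>, and its inverse is the conjugate of the inverse of \<open>h\<close>. The
  hypothesis has the shape of the equivariance equation for the skeleton and leaves
  \<open>h'\<close> free off \<open>M\<close>.\<close>

lemma diffeomorphism_conjugate:
  assumes g: "g \<in> carrier G" and h: "diffeomorphism M h"
    and h': "\<And>x. x \<in> points M \<Longrightarrow> h' (act g x) = act g (h x)"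
  shows "diffeomorphism M h'"
proof -
  let ?P = "points M" and ?k = "inv_into (points M) h"
  have bij: "bij_betw h ?P ?P" and smooth: "smooth_map M M h" "smooth_map M M ?k"
    using h by (auto simp: diffeomorphism_def)
  have ginv: "inv\<^bsub>G\<^esub> g \<in> carrier G"
    using g by simp
  note compose = smooth_map_compose[OF smooth_manifold smooth_manifold smooth_manifold]
  note cong = smooth_map_cong[OF smooth_manifold smooth_manifold]
  have eq: "act g (h (act (inv\<^bsub>G\<^esub> g) x)) = h' x" if "x \<in> ?P" for x
    using h'[OF act_closed[OF ginv that]] act_act_inv[OF g that] by simp
  have bij': "bij_betw h' ?P ?P"
  proof -
    have "bij_betw (act g \<circ> (h \<circ> act (inv\<^bsub>G\<^esub> g))) ?P ?P"
      using bij_betw_trans bij bij_betw_act g ginv by metis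
    then show ?thesis
      by (rule iffD1[OF bij_betw_cong, rotated]) (simp add: eq)
  qed
  have "smooth_map M M h'"
    by (rule cong[OF eq compose[OF compose[OF act_smooth[OF ginv] smooth(1)] act_smooth[OF g]]])
  moreover have "smooth_map M M (inv_into ?P h')"
  proof (rule cong[OF _ compose[OF compose[OF act_smooth[OF ginv] smooth(2)] act_smooth[OF g]]])
    fix y assume y: "y \<in> ?P"
    let ?x = "?k (act (inv\<^bsub>G\<^esub> g) y)"
    have "act (inv\<^bsub>G\<^esub> g) y \<in> h ` ?P"
      using bij act_closed[OF ginv y] by (simp add: bij_betw_def)
    then have "?x \<in> ?P" "h ?x = act (inv\<^bsub>G\<^esub> g) y"
      by (rule inv_into_into, rule f_inv_into_f)
    then have "act g ?x \<in> ?P" "h' (act g ?x) = y"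
      using h' act_closed[OF g] act_act_inv[OF g y] by auto
    then show "act g ?x = inv_into ?P h' y"
      using bij' by (metis bij_betw_def inv_into_f_eq)
  qed
  ultimately show ?thesis
    using bij' by (simp add: diffeomorphism_def)
qed

section \<open>Equivariance of the skeleton\<close>

lemma Ad_stages_closed:
  "g \<in> carrier G \<Longrightarrow> F \<in> stage_values G T \<Longrightarrow> Ad_stages G T g F \<in> stage_values G T"
  by (auto simp: stage_values_def Ad_stages_def intro!: Ad_closed)

lemma Ad_stages_inv:
  assumes "g \<in> carrier G" "F \<in> stage_values G T"
  shows "Ad_stages G T (inv\<^bsub>G\<^esub> g) (Ad_stages G T g F) = F"
proof -
  have "F i \<in> lie_algebra G" if "i \<in> stages T" for i
    using assms that by (auto simp: stage_values_def)
  then have "Ad_stages G T (inv\<^bsub>G\<^esub> g) (Ad_stages G T g F) = restrict F (stages T)"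
    unfolding Ad_stages_def using assms
    by (intro restrict_ext) (simp add: Ad_inv_Ad)
  also have "\<dots> = F"
    using assms by (auto simp: stage_values_def PiE_def extensional_restrict)
  finally show ?thesis .
qed

text \<open>Both components stay extensional, which lets translates be compared as functions with
  the unique solution.\<close>

definition translate_solution ::
    "'v stage_tree_data \<Rightarrow> 'g \<Rightarrow> ('v \<Rightarrow> 'm) \<times> ('v \<Rightarrow> 'g tangent) \<Rightarrow> ('v \<Rightarrow> 'm) \<times> ('v \<Rightarrow> 'g tangent)"
  where "translate_solution T g = (\<lambda>(X, F). (\<lambda>i\<in>stages T. act g (X i), Ad_stages G T g F))"

lemma translate_solution_inv:
  assumes g: "g \<in> carrier G" and sol: "skeleton_solution G M act T \<Psi> \<nu> x0 XF"
  shows "translate_solution T (inv\<^bsub>G\<^esub> g) (translate_solution T g XF) = XF"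
proof -
  obtain X F where XF: "XF = (X, F)" by fastforce
  with sol have X: "X \<in> stages T \<rightarrow>\<^sub>E points M" and F: "F \<in> stage_values G T"
    by (auto simp: skeleton_solution_def)
  have "X i \<in> points M" if "i \<in> stages T" for i
    using X that by auto
  then have "(\<lambda>i\<in>stages T. act (inv\<^bsub>G\<^esub> g) ((\<lambda>i\<in>stages T. act g (X i)) i)) = restrict X (stages T)"
    using g by (intro restrict_ext) (simp add: act_inv_act)
  also have "\<dots> = X"
    using X by (auto simp: PiE_def extensional_restrict)
  finally show ?thesis
    using Ad_stages_inv[OF g F] by (simp add: XF translate_solution_def)
qed

lemma skeleton_solution_translate:
  assumes T: "stage_tree T" and motions: "motions G T \<Psi>" and equiv: "equivariant_motions G T \<Psi>"
    and g: "g \<in> carrier G" and sol: "skeleton_solution G M act T \<Psi> \<nu> x0 XF"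
  shows "skeleton_solution G M act T \<Psi> (act_lie_map G M act g \<nu>) (act g x0) (translate_solution T g XF)"
proof -
  obtain X F where XF: "XF = (X, F)" by fastforce
  with sol have X: "X \<in> stages T \<rightarrow>\<^sub>E points M" and F: "F \<in> stage_values G T"
    and init: "X (initial T) = x0"
    and edge: "\<And>i j. (i, j) \<in> edges T \<Longrightarrow> X i = act (\<Psi> i j F) (X j)"
    and val: "\<And>i. i \<in> stages T \<Longrightarrow> F i = \<nu> (X i)"
    by (auto simp: skeleton_solution_def)
  have XP: "X i \<in> points M" if "i \<in> stages T" for i
    using X that by auto
  have tree: "edges T \<subseteq> stages T \<times> stages T" "initial T \<in> stages T"
    using T by (auto simp: stage_tree_def)
  have "act g (X i) = act (\<Psi> i j (Ad_stages G T g F)) (act g (X j))" if e: "(i, j) \<in> edges T" for i j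
  proof -
    have \<Psi>: "\<Psi> i j F \<in> carrier G" "\<Psi> i j (Ad_stages G T g F) = g \<otimes>\<^bsub>G\<^esub> \<Psi> i j F \<otimes>\<^bsub>G\<^esub> inv\<^bsub>G\<^esub> g"
      using motions equiv e F g unfolding motions_def equivariant_motions_def by blast+
    have "X j \<in> points M"
      using XP tree e by blast
    then show ?thesis
      using \<Psi> g edge[OF e] by (simp add: action.composition_rule act_closed act_inv_act)
  qed
  moreover have "Ad_stages G T g F i = Ad G g (F i)" if "i \<in> stages T" for i
    using that by (simp add: Ad_stages_def)
  \<comment> \<open>Both ends of an edge are stages, so the restricted family takes its translated
    values there.\<close>
  moreover have "i \<in> stages T \<and> j \<in> stages T" if "(i, j) \<in> edges T" for i j
    using that tree(1) by blast
  ultimately show ?thesis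
    using XP F g tree(2) init val Ad_stages_closed[OF g F]
    by (auto simp: XF translate_solution_def skeleton_solution_def act_closed act_lie_map_act)
qed

lemma skeleton_unique_solution_translate:
  assumes T: "stage_tree T" and motions: "motions G T \<Psi>" and equiv: "equivariant_motions G T \<Psi>"
    and g: "g \<in> carrier G" and \<nu>: "\<nu> \<in> smooth_lie_maps G M" and x0: "x0 \<in> points M"
    and unique: "\<exists>!XF. skeleton_solution G M act T \<Psi> \<nu> x0 XF"
  shows "\<exists>!XF. skeleton_solution G M act T \<Psi> (act_lie_map G M act g \<nu>) (act g x0) XF"
    and "skeleton G M act T \<Psi> (act_lie_map G M act g \<nu>) (act g x0) = act g (skeleton G M act T \<Psi> \<nu> x0)"
proof -
  let ?sol = "skeleton_solution G M act T \<Psi>" and ?g\<nu> = "act_lie_map G M act g \<nu>"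
  obtain XF where XF: "?sol \<nu> x0 XF" and only: "\<And>YF. ?sol \<nu> x0 YF \<Longrightarrow> YF = XF"
    using unique by blast
  have sol: "?sol ?g\<nu> (act g x0) (translate_solution T g XF)"
    using skeleton_solution_translate[OF T motions equiv g XF] .
  \<comment> \<open>A competitor translated back by the inverse of \<open>g\<close> solves the
    original system, hence is \<open>XF\<close>; translating forward again recovers the
    competitor.\<close>
  have eq: "YF = translate_solution T g XF" if YF: "?sol ?g\<nu> (act g x0) YF" for YF
  proof -
    have ginv: "inv\<^bsub>G\<^esub> g \<in> carrier G"
      using g by simp
    have "?sol \<nu> x0 (translate_solution T (inv\<^bsub>G\<^esub> g) YF)"
      using skeleton_solution_translate[OF T motions equiv ginv YF]
      by (simp add: act_lie_map_inv[OF g \<nu>] act_inv_act[OF g x0])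
    then show ?thesis
      using only translate_solution_inv[OF ginv YF] g by (metis inv_inv)
  qed
  show "\<exists>!XF. ?sol ?g\<nu> (act g x0) XF"
    using sol eq by blast
  \<comment> \<open>Uniqueness on both sides evaluates the definite descriptions in
    \<open>skeleton\<close>; the equation is then read off at the final vertex, a stage, where the
    restriction is not \<open>undefined\<close>.\<close>
  have "(THE YF. ?sol ?g\<nu> (act g x0) YF) = translate_solution T g XF" "(THE YF. ?sol \<nu> x0 YF) = XF"
    using sol eq XF only by (blast intro: the_equality)+
  moreover have "final T \<in> stages T"
    using T by (simp add: stage_tree_def)
  ultimately show "skeleton G M act T \<Psi> ?g\<nu> (act g x0) = act g (skeleton G M act T \<Psi> \<nu> x0)"
    by (simp add: skeleton_def translate_solution_def split_beta)
qed

section \<open>The three equivariance claims\<close>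

lemma equivariant_motions_compose:
  assumes trans: "transition_functions G T \<theta>"
    and \<Psi>: "\<forall>(i, j)\<in>edges T. \<forall>F\<in>stage_values G T. \<Psi> i j F = \<psi> (\<theta> i j F)"
    and equiv: "equivariant_motion_map G \<psi>" "equivariant_transition_functions G T \<theta>"
  shows "equivariant_motions G T \<Psi>"
proof -
  have "\<Psi> i j (Ad_stages G T g F) = g \<otimes>\<^bsub>G\<^esub> \<Psi> i j F \<otimes>\<^bsub>G\<^esub> inv\<^bsub>G\<^esub> g"
    if "(i, j) \<in> edges T" "g \<in> carrier G" "F \<in> stage_values G T" for i j g F
  proof -
    have "\<theta> i j F \<in> lie_algebra G" "\<theta> i j (Ad_stages G T g F) = Ad G g (\<theta> i j F)"
      using that trans equiv(2)
      unfolding transition_functions_def equivariant_transition_functions_def by blast+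
    \<comment> \<open>The factorization is used at \<open>F\<close> and at its translate, which is
      again a stage value by \<open>Ad_stages_closed\<close>.\<close>
    moreover have "\<Psi> i j F' = \<psi> (\<theta> i j F')" if "F' \<in> stage_values G T" for F'
      using \<Psi> that \<open>(i, j) \<in> edges T\<close> by blast
    ultimately show ?thesis
      using that equiv(1) by (simp add: Ad_stages_closed equivariant_motion_map_def)
  qed
  then show ?thesis
    by (auto simp: equivariant_motions_def)
qed

lemma equivariant_skeletonI:
  assumes "stage_tree T" "motions G T \<Psi>" "equivariant_motions G T \<Psi>"
  shows "equivariant_skeleton G M act T \<Psi>"
  unfolding equivariant_skeleton_def equivariant_on_def
proof (intro ballI conjI)
  fix g \<nu>
  assume g: "g \<in> carrier G" and scaled: "\<nu> \<in> scaled G M act T \<Psi>"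
  let ?g\<nu> = "act_lie_map G M act g \<nu>"
  have \<nu>: "\<nu> \<in> smooth_lie_maps G M"
    and unique: "\<And>x. x \<in> points M \<Longrightarrow> \<exists>!XF. skeleton_solution G M act T \<Psi> \<nu> x XF"
    and diff: "diffeomorphism M (skeleton G M act T \<Psi> \<nu>)"
    using scaled by (auto simp: scaled_def)
  note translate = skeleton_unique_solution_translate[OF assms g \<nu> _ unique]
  show eq: "skeleton G M act T \<Psi> ?g\<nu> (act g x) = act g (skeleton G M act T \<Psi> \<nu> x)"
    if "x \<in> points M" for x
    using translate(2)[OF that that] .
  \<comment> \<open>Unique solvability is known at initial points of the form
    \<open>act g y\<close>; every point has this form with \<open>y = act (inv g) x\<close>.\<close>
  have "\<exists>!XF. skeleton_solution G M act T \<Psi> ?g\<nu> x XF" if x: "x \<in> points M" for x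
  proof -
    have "act (inv\<^bsub>G\<^esub> g) x \<in> points M"
      using g x by (simp add: act_closed)
    from translate(1)[OF this this] show ?thesis
      by (simp only: act_act_inv[OF g x])
  qed
  then show "?g\<nu> \<in> scaled G M act T \<Psi>"
    using act_lie_map_closed[OF g \<nu>] diffeomorphism_conjugate[OF g diff eq]
    by (simp add: scaled_def)
qed

text \<open>Equivariance of \<open>\<omega>\<close> rewrites the value at a translated field as the
  skeleton at a translated map. The same rewriting transfers invariance of the domain, together with
  \<open>act_field_closed\<close>.\<close>

lemma equivariant_methodI:
  assumes "equivariant_skeleton G M act T \<Psi>" "equivariant_isotropy G M act \<omega>"
  shows "equivariant_method G M act T \<Psi> \<omega>"
  using assms act_field_closed
  by (simp add: equivariant_method_def equivariant_skeleton_def equivariant_isotropy_def equivariant_on_def)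

end

theorem proposition3p2:
  fixes G :: "('g, 'a::real_inner) lie_group_data"
    and M :: "('m, 'b::real_inner) manifold"
    and act :: "'g \<Rightarrow> 'm \<Rightarrow> 'm"
    and T :: "'v stage_tree_data"
    and \<Psi> :: "'v \<Rightarrow> 'v \<Rightarrow> ('v \<Rightarrow> 'g tangent) \<Rightarrow> 'g"
    and \<omega> :: "('m \<Rightarrow> 'm tangent) \<Rightarrow> 'm \<Rightarrow> 'g tangent"
  assumes "lie_group G"
    and "smooth_manifold M"
    and "smooth_transitive_action G M act"
    and "stage_tree T"
    and "motions G T \<Psi>"
    and "isotropy_map G M act \<omega>"
  shows "(\<forall>(\<psi> :: 'g tangent \<Rightarrow> 'g) (\<theta> :: 'v \<Rightarrow> 'v \<Rightarrow> ('v \<Rightarrow> 'g tangent) \<Rightarrow> 'g tangent).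
            motion_map G \<psi> \<and> transition_functions G T \<theta> \<and>
            (\<forall>(i, j)\<in>edges T. \<forall>F\<in>stage_values G T. \<Psi> i j F = \<psi> (\<theta> i j F)) \<and>
            equivariant_motion_map G \<psi> \<and> equivariant_transition_functions G T \<theta>
            \<longrightarrow> equivariant_motions G T \<Psi>) \<and>
         (equivariant_motions G T \<Psi> \<longrightarrow> equivariant_skeleton G M act T \<Psi>) \<and>
         (equivariant_skeleton G M act T \<Psi> \<and> equivariant_isotropy G M act \<omega>
            \<longrightarrow> equivariant_method G M act T \<Psi> \<omega>)"
proof -
  interpret lie_group_action G M act
    using assms(1-3) by unfold_locales
  show ?thesis
    using equivariant_motions_compose equivariant_skeletonI[OF assms(4,5)] equivariant_methodI
    by blast
qed

end
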